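(* Assume (three-channel chart visibility) that there is a selection $\zeta_\ast(\mathcal D)\in\Gamma_\Lambda^{\mathrm{int}}$ and constants $\kappa_0,\kappa_{\mathrm{proj}},\kappa_{\mathrm{harm}}>0$, $\delta_0,\delta_{\mathrm{proj}},\delta_{\mathrm{harm}}\ge0$ such that every intrinsic package $\mathcal D$ satisfies $$\operatorname{dist}_{\mathrm{cl}}(\Theta_\Lambda\mathcal D,\Gamma_\Lambda^{\mathrm{cl}})\ge\kappa_0\|\mathcal D-\zeta_\ast\|_{\mathrm{loc,int}}-\delta_0,$$ $$\operatorname{dist}_{\mathrm{cl}}(\Theta_\Lambda\mathcal D,\Gamma_\Lambda^{\mathrm{cl}})\ge\kappa_{\mathrm{proj}}\,\alpha_{\mathrm{proj}}\mathcal T_{\mathrm{proj}}(\mathcal D;\zeta_\ast)-\delta_{\mathrm{proj}},$$ $$\operatorname{dist}_{\mathrm{cl}}(\Theta_\Lambda\mathcal D,\Gamma_\Lambda^{\mathrm{cl}})\ge\kappa_{\mathrm{harm}}\,\alpha_{\mathrm{harm}}\mathcal T_{\mathrm{harm}}(\mathcal D;\zeta_\ast)-\delta_{\mathrm{harm}}.$$ Set $\kappa_\ast=\min\{\kappa_0,\kappa_{\mathrm{proj}},\kappa_{\mathrm{harm}}\}$, $\lambda_G=\min\{1,\kappa_\ast/3\}$ and $\delta_G^{\mathrm{vis}}=(\delta_0+\delta_{\mathrm{proj}}+\delta_{\mathrm{harm}})/3$. Then for every intrinsic package $\mathcal D$, $$\operatorname{dist}_{\mathrm{cl}}(\Theta_\Lambda\mathcal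 D,\Gamma_\Lambda^{\mathrm{cl}})\ge\lambda_G\operatorname{dist}^{\sharp,\mathrm{tail}}(\mathcal D)-\delta_G^{\mathrm{vis}}.$$ Equivalently, the comparison $\operatorname{dist}_{\mathrm{cl}}(\Theta_\Lambda\mathcal D,\Gamma_\Lambda^{\mathrm{cl}})\ge(1-\varepsilon_G)\operatorname{dist}^{\sharp,\mathrm{tail}}(\mathcal D)-\delta_G$ holds with $1-\varepsilon_G=\lambda_G$ and $\delta_G=\delta_G^{\mathrm{vis}}$.
   Context: Clean space: $\mathcal K_\Lambda^{\mathrm{cl}}$ is a finite-dimensional real normed space with norm $\|\cdot\|_{\mathrm{cl}}$ and linear subspace $\Gamma_\Lambda^{\mathrm{cl}}$; $\operatorname{dist}_{\mathrm{cl}}(d,\Gamma_\Lambda^{\mathrm{cl}})=\inf_{\gamma\in\Gamma_\Lambda^{\mathrm{cl}}}\|d-\gamma\|_{\mathrm{cl}}$. Intrinsic packages. $\Lambda$ is a finite set of consecutive integers. For $k\in\Lambda$, $j=1,\dots,7$, let $X_k^{(j)}$ be normed spaces; an intrinsic package is $\mathcal D=(x_k^{(j)})_{k,j}$, $x_k^{(j)}\in X_k^{(j)}$, with norm $\|\mathcal D\|_{\mathrm{loc,int}}^2=\sum_{k}\sum_{j}a_j\|x_k^{(j)}\|^2$, $a_j>0$ fixed; $\mathfrak I_\Lambda^{\mathrm{loc}}$ is the space of intrinsic packages and $\Gamma_\Lambda^{\mathrm{int}}\subset\mathfrak I_\Lambda^{\mathrm{loc}}$ a linear subspace. $\Theta_\Lambda:\mathfrak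 I_\Lambda^{\mathrm{loc}}\to\mathcal K_\Lambda^{\mathrm{cl}}$ is a map (the local-to-clean chart). Enhanced-tail distance. Let $B_r\subset\mathbb R^3$ be the ball of radius $r$ about $0$, $I=(-1,0)$, $Y_{\mathrm{prs}}=L^{3/2}(I;L^{3/2}(B_{1/2}))$, and $\mathsf R_i$ the Riesz transforms on $\mathbb R^3$ (tensors on $B_1$ are extended by zero, repeated indices summed, results restricted to $B_{1/2}$). Each package $\mathcal D$ carries a clean source tensor $F^{\mathrm{cl}}_{ij}(\mathcal D)=U_iU_j+R_{ij}\in L^{3/2}(I;L^{3/2}(B_1))$ built from its clean velocity and covariance coordinates $U,R$, and a harmonic pressure component $p_{\mathrm{harm}}(\mathcal D)$ in a normed space $Y_{\mathrm{harm}}$. $P_{\mathrm{prs},N}^{\mathrm{cl}}$ is a bounded linear projection on $Y_{\mathrm{prs}}$, $\Pi_{\mathrm{harm},M}$ a bounded projection of $Y_{\mathrm{harm}}$ onto a finite-dimensional subspace, $J_{\mathrm{harm}}:Y_{\mathrm{harm}}\to Y_{\mathrm{prs}}$ bounded linear. For $\zeta\in\Gamma_\Lambda^{\mathrm{int}}$, $\mathcal T_{\mathrm{proj}}(\mathcal D;\zeta)=(1+\|P_{\mathrm{prs},N}^{\mathrm{cl}}\|)\|\mathsf R_i\mathsf R_jF_{ij}^{\mathrm{cl}}(\mathcal D-\zeta)\|_{Y_{\mathrm{prs}}}$, $\mathcal T_{\mathrm{harm}}(\mathcal D;\zeta)=\|J_{\mathrm{harm}}\|\,\|(I-\Pi_{\mathrm{harm},M})p_{\mathrm{harm}}(\mathcal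 D-\zeta)\|_{Y_{\mathrm{harm}}}$. For fixed $\alpha_{\mathrm{proj}},\alpha_{\mathrm{harm}}>0$, $$\operatorname{dist}^{\sharp,\mathrm{tail}}(\mathcal D)=\inf_{\zeta\in\Gamma_\Lambda^{\mathrm{int}}}\big(\|\mathcal D-\zeta\|_{\mathrm{loc,int}}+\alpha_{\mathrm{proj}}\mathcal T_{\mathrm{proj}}(\mathcal D;\zeta)+\alpha_{\mathrm{harm}}\mathcal T_{\mathrm{harm}}(\mathcal D;\zeta)\big).$$ *)

theory Defs
  imports "HOL-Analysis.Analysis" "HOL-Library.Function_Algebras"
begin

text \<open>
  Packages are families \<^term>\<open>D k j\<close>; the pointwise scalar multiplication completes the pointwise
  additive structure of \<^theory>\<open>HOL-Library.Function_Algebras\<close>, so that \<^const>\<open>subspace\<close> applies.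
\<close>

instantiation "fun" :: (type, real_vector) real_vector
begin

definition scaleR_fun :: "real \<Rightarrow> ('a \<Rightarrow> 'b) \<Rightarrow> 'a \<Rightarrow> 'b"
  where "scaleR_fun c f = (\<lambda>x. c *\<^sub>R f x)"

instance
  by standard (auto simp: scaleR_fun_def plus_fun_def fun_eq_iff algebra_simps)

end

definition Lp_space :: "real \<Rightarrow> 'a measure \<Rightarrow> ('a \<Rightarrow> real) set"
  where "Lp_space p M = {f \<in> borel_measurable M. integrable M (\<lambda>x. \<bar>f x\<bar> powr p)}"

definition Lp_norm :: "real \<Rightarrow> 'a measure \<Rightarrow> ('a \<Rightarrow> real) \<Rightarrow> real"
  where "Lp_norm p M f = (LINT x|M. \<bar>f x\<bar> powr p) powr (1 / p)"

lemma Lp_norm_nonneg: "0 \<le> Lp_norm p M f"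
  by (simp add: Lp_norm_def)

lemma Lp_norm_powr:
  assumes "p > 0"
  shows "Lp_norm p M f powr p = (LINT x|M. \<bar>f x\<bar> powr p)"
  using assms by (simp add: Lp_norm_def powr_powr)

lemma powr_convex_nonneg:
  fixes p l x y :: real
  assumes p: "p \<ge> 1" and l: "0 \<le> l" "l \<le> 1" and xy: "0 \<le> x" "0 \<le> y"
  shows "((1 - l) * x + l * y) powr p \<le> (1 - l) * x powr p + l * y powr p"
proof -
  have le: "(m * z) powr p \<le> m * z powr p" if "0 \<le> m" "m \<le> 1" "0 \<le> z" for m z :: real
  proof -
    have "m powr p \<le> m"
      using that p powr_mono'[of 1 p m] by (cases "m = 0") auto
    then show ?thesis using that by (simp add: powr_mult mult_right_mono)
  qed
  show ?thesis
  proof (cases "x = 0 \<or> y = 0")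
    case True
    then show ?thesis
      using le[of l y] le[of "1 - l" x] l xy p by auto
  next
    case False
    with xy have "x \<in> {0<..}" "y \<in> {0<..}" by auto
    then show ?thesis
      using convex_onD[OF powr_convex[OF p], of l x y] l by simp
  qed
qed

lemma Lp_pointwise:
  fixes p S T a b :: real
  assumes p: "p \<ge> 1" and ST: "S > 0" "T > 0"
  shows "\<bar>a + b\<bar> powr p
    \<le> (S + T) powr p * (S / (S + T) * (\<bar>a\<bar> powr p / S powr p) + T / (S + T) * (\<bar>b\<bar> powr p / T powr p))"
proof -
  define l where "l = T / (S + T)"
  have l: "0 \<le> l" "l \<le> 1" "1 - l = S / (S + T)"
    using ST by (auto simp: l_def field_simps)
  have eq: "\<bar>a\<bar> + \<bar>b\<bar> = (S + T) * ((1 - l) * (\<bar>a\<bar> / S) + l * (\<bar>b\<bar> / T))"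
  proof -
    have "(1 - l) * (\<bar>a\<bar> / S) = \<bar>a\<bar> / (S + T)" "l * (\<bar>b\<bar> / T) = \<bar>b\<bar> / (S + T)"
      using ST unfolding l(3) by (simp_all add: l_def)
    then show ?thesis using ST by (simp add: distrib_left)
  qed
  have "\<bar>a + b\<bar> powr p \<le> (\<bar>a\<bar> + \<bar>b\<bar>) powr p"
    using p by (intro powr_mono2) auto
  also have "\<dots> = (S + T) powr p * ((1 - l) * (\<bar>a\<bar> / S) + l * (\<bar>b\<bar> / T)) powr p"
    unfolding eq by (rule powr_mult)
  also have "\<dots> \<le> (S + T) powr p * ((1 - l) * (\<bar>a\<bar> / S) powr p + l * (\<bar>b\<bar> / T) powr p)"
    using powr_convex_nonneg[OF p l(1,2), of "\<bar>a\<bar> / S" "\<bar>b\<bar> / T"] ST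
    by (intro mult_left_mono) auto
  finally show ?thesis
    using ST unfolding l(3) by (simp add: l_def powr_divide)
qed

lemma Lp_space_add:
  assumes p: "p \<ge> 1" and f: "f \<in> Lp_space p M" and g: "g \<in> Lp_space p M"
  shows "(\<lambda>x. f x + g x) \<in> Lp_space p M"
proof -
  have [measurable]: "f \<in> borel_measurable M" "g \<in> borel_measurable M"
    and int: "integrable M (\<lambda>x. \<bar>f x\<bar> powr p)" "integrable M (\<lambda>x. \<bar>g x\<bar> powr p)"
    using f g by (auto simp: Lp_space_def)
  have "integrable M (\<lambda>x. \<bar>f x + g x\<bar> powr p)"
  proof (rule Bochner_Integration.integrable_bound)
    show "integrable M (\<lambda>x. 2 powr p * (1/2 * (\<bar>f x\<bar> powr p) + 1/2 * (\<bar>g x\<bar> powr p)))"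
      using int by (intro integrable_mult_right Bochner_Integration.integrable_add) auto
    show "AE x in M. norm (\<bar>f x + g x\<bar> powr p)
        \<le> norm (2 powr p * (1/2 * (\<bar>f x\<bar> powr p) + 1/2 * (\<bar>g x\<bar> powr p)))"
      using Lp_pointwise[OF p, of 1 1] by (intro AE_I2) auto
  qed measurable
  then show ?thesis by (auto simp: Lp_space_def)
qed

lemma Lp_space_scale:
  assumes "f \<in> Lp_space p M"
  shows "(\<lambda>x. c * f x) \<in> Lp_space p M"
  using assms by (auto simp: Lp_space_def abs_mult powr_mult)

lemma Lp_norm_scale:
  assumes "p > 0"
  shows "Lp_norm p M (\<lambda>x. c * f x) = \<bar>c\<bar> * Lp_norm p M f"
  using assms by (simp add: Lp_norm_def abs_mult powr_mult powr_powr)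

lemma Lp_norm_cong_AE:
  assumes "f \<in> Lp_space p M" "g \<in> Lp_space p M" "AE x in M. f x = g x"
  shows "Lp_norm p M f = Lp_norm p M g"
proof -
  have "(LINT x|M. \<bar>f x\<bar> powr p) = (LINT x|M. \<bar>g x\<bar> powr p)"
    using assms by (intro integral_cong_AE) (auto simp: Lp_space_def)
  then show ?thesis by (simp add: Lp_norm_def)
qed

lemma Lp_norm_eq_0_iff:
  assumes "p > 0" "f \<in> Lp_space p M"
  shows "Lp_norm p M f = 0 \<longleftrightarrow> (AE x in M. f x = 0)"
proof -
  have "Lp_norm p M f = 0 \<longleftrightarrow> (LINT x|M. \<bar>f x\<bar> powr p) = 0"
    using assms by (simp add: Lp_norm_def)
  also have "\<dots> \<longleftrightarrow> (AE x in M. \<bar>f x\<bar> powr p = 0)"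
    using assms by (intro integral_nonneg_eq_0_iff_AE) (auto simp: Lp_space_def)
  finally show ?thesis by simp
qed

lemma Lp_norm_triangle:
  assumes p: "p \<ge> 1" and f: "f \<in> Lp_space p M" and g: "g \<in> Lp_space p M"
  shows "Lp_norm p M (\<lambda>x. f x + g x) \<le> Lp_norm p M f + Lp_norm p M g"
proof -
  have fg: "(\<lambda>x. f x + g x) \<in> Lp_space p M" by (rule Lp_space_add[OF p f g])
  define S T where "S = Lp_norm p M f" and "T = Lp_norm p M g"
  have nn: "S \<ge> 0" "T \<ge> 0" by (auto simp: S_def T_def Lp_norm_nonneg)
  have p0: "p > 0" using p by simp
  consider "S = 0" | "T = 0" | "S > 0" "T > 0" using nn by linarith
  then show ?thesis
  proof cases
    case 1
    then have "AE x in M. f x + g x = g x"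
      using Lp_norm_eq_0_iff[OF p0 f] by (auto simp: S_def)
    then show ?thesis using Lp_norm_cong_AE[OF fg g] by (simp add: Lp_norm_nonneg)
  next
    case 2
    then have "AE x in M. f x + g x = f x"
      using Lp_norm_eq_0_iff[OF p0 g] by (auto simp: T_def)
    then show ?thesis using Lp_norm_cong_AE[OF fg f] by (simp add: Lp_norm_nonneg)
  next
    case 3
    have int: "integrable M (\<lambda>x. \<bar>f x\<bar> powr p)" "integrable M (\<lambda>x. \<bar>g x\<bar> powr p)"
      "integrable M (\<lambda>x. \<bar>f x + g x\<bar> powr p)"
      using f g fg by (auto simp: Lp_space_def)
    have I: "(LINT x|M. \<bar>f x\<bar> powr p) = S powr p" "(LINT x|M. \<bar>g x\<bar> powr p) = T powr p"
      unfolding S_def T_def by (simp_all add: Lp_norm_powr[OF p0])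
    have "(LINT x|M. \<bar>f x + g x\<bar> powr p)
        \<le> (LINT x|M. (S + T) powr p * (S / (S + T) * (\<bar>f x\<bar> powr p / S powr p)
                                       + T / (S + T) * (\<bar>g x\<bar> powr p / T powr p)))"
      using int Lp_pointwise[OF p 3]
      by (intro integral_mono integrable_mult_right Bochner_Integration.integrable_add) auto
    also have "\<dots> = (S + T) powr p * (S / (S + T) * (S powr p / S powr p)
                                       + T / (S + T) * (T powr p / T powr p))"
      using int by (simp add: I)
    also have "\<dots> = (S + T) powr p"
      using 3 by (simp add: add_divide_distrib[symmetric])
    finally have "(LINT x|M. \<bar>f x + g x\<bar> powr p) powr (1 / p) \<le> ((S + T) powr p) powr (1 / p)"
      using p0 by (intro powr_mono2) auto
    then show ?thesis
      using 3 p0 by (simp add: Lp_norm_def[of p M "\<lambda>x. f x + g x"] S_def T_def powr_powr)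
  qed
qed

text \<open>
  The Bochner space \<open>L\<^sup>3\<^sup>/\<^sup>2(I; L\<^sup>3\<^sup>/\<^sup>2(B\<^sub>r))\<close>, with \<open>I = (-1,0)\<close>, is represented by the jointly Lebesgue
  measurable functions on the cylinder \<open>I \<times> B\<^sub>r\<close> whose power \<open>3/2\<close> is integrable; lemma
  \<open>cylinder_iterated\<close> below shows that the norm is the iterated one.
\<close>

type_synonym spacetime = "real \<times> (real^3)"

definition cylinder :: "real \<Rightarrow> spacetime measure"
  where "cylinder r = lebesgue_on ({-1<..<0} \<times> ball 0 r)"

lemma cylinder_iterated:
  assumes [measurable]: "f \<in> borel_measurable borel" and f: "f \<in> Lp_space (3/2) (cylinder r)"
  shows "ennreal (Lp_norm (3/2) (cylinder r) f powr (3/2))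
    = (\<integral>\<^sup>+t\<in>{-1<..<0}. (\<integral>\<^sup>+x\<in>ball 0 r. ennreal (\<bar>f (t, x)\<bar> powr (3/2)) \<partial>lborel) \<partial>lborel)"
proof -
  let ?C = "{-1<..<0::real} \<times> ball (0::real^3) r"
  have C[measurable]: "?C \<in> sets borel" by (intro borel_open open_Times) auto
  have "ennreal (Lp_norm (3/2) (cylinder r) f powr (3/2))
      = (\<integral>\<^sup>+z. ennreal (\<bar>f z\<bar> powr (3/2)) \<partial>cylinder r)"
    using f by (simp add: Lp_norm_powr Lp_space_def nn_integral_eq_integral)
  also have "\<dots> = (\<integral>\<^sup>+z\<in>?C. ennreal (\<bar>f z\<bar> powr (3/2)) \<partial>lebesgue)"
    using C unfolding cylinder_def by (subst nn_integral_restrict_space) auto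
  also have "\<dots> = (\<integral>\<^sup>+z\<in>?C. ennreal (\<bar>f z\<bar> powr (3/2)) \<partial>(lborel \<Otimes>\<^sub>M lborel))"
    by (simp add: nn_integral_completion lborel_prod)
  also have "\<dots> = (\<integral>\<^sup>+t. (\<integral>\<^sup>+x. ennreal (\<bar>f (t, x)\<bar> powr (3/2)) * indicator ?C (t, x) \<partial>lborel) \<partial>lborel)"
    by (subst lborel.nn_integral_fst[symmetric]) (auto simp: lborel_prod)
  also have "\<dots> = (\<integral>\<^sup>+t\<in>{-1<..<0}. (\<integral>\<^sup>+x\<in>ball 0 r. ennreal (\<bar>f (t, x)\<bar> powr (3/2)) \<partial>lborel) \<partial>lborel)"
    by (intro nn_integral_cong) (auto simp: indicator_def)
  finally show ?thesis .
qed

definition Yprs_rel :: "(spacetime \<Rightarrow> real) \<Rightarrow> (spacetime \<Rightarrow> real) \<Rightarrow> bool"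
  where "Yprs_rel f g \<longleftrightarrow> f \<in> Lp_space (3/2) (cylinder (1/2)) \<and> g \<in> Lp_space (3/2) (cylinder (1/2))
      \<and> (AE z in cylinder (1/2). f z = g z)"

quotient_type Yprs = "spacetime \<Rightarrow> real" / partial: Yprs_rel
proof (rule part_equivpI)
  show "\<exists>f. Yprs_rel f f"
    by (rule exI[of _ "\<lambda>_. 0"]) (auto simp: Yprs_rel_def Lp_space_def)
  show "symp Yprs_rel"
    by (auto simp: symp_def Yprs_rel_def elim: AE_mp)
  show "transp Yprs_rel"
    by (auto simp: transp_def Yprs_rel_def)
qed

instantiation Yprs :: real_normed_vector
begin

lift_definition zero_Yprs :: Yprs is "\<lambda>_. 0"
  by (auto simp: Yprs_rel_def Lp_space_def)

lift_definition plus_Yprs :: "Yprs \<Rightarrow> Yprs \<Rightarrow> Yprs" is "\<lambda>f g z. f z + g z"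
  by (auto simp: Yprs_rel_def intro: Lp_space_add)

lift_definition scaleR_Yprs :: "real \<Rightarrow> Yprs \<Rightarrow> Yprs" is "\<lambda>c f z. c * f z"
  by (auto simp: Yprs_rel_def intro: Lp_space_scale)

lift_definition norm_Yprs :: "Yprs \<Rightarrow> real" is "Lp_norm (3/2) (cylinder (1/2))"
  by (auto simp: Yprs_rel_def intro: Lp_norm_cong_AE)

definition uminus_Yprs :: "Yprs \<Rightarrow> Yprs" where "uminus_Yprs f = (-1) *\<^sub>R f"

definition minus_Yprs :: "Yprs \<Rightarrow> Yprs \<Rightarrow> Yprs" where "minus_Yprs f g = f + - g"

definition sgn_Yprs :: "Yprs \<Rightarrow> Yprs" where "sgn_Yprs f = inverse (norm f) *\<^sub>R f"

definition dist_Yprs :: "Yprs \<Rightarrow> Yprs \<Rightarrow> real" where "dist_Yprs f g = norm (f - g)"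

definition uniformity_Yprs :: "(Yprs \<times> Yprs) filter"
  where "uniformity_Yprs = (INF e\<in>{0<..}. principal {(f, g). dist f g < e})"

definition open_Yprs :: "Yprs set \<Rightarrow> bool"
  where "open_Yprs S \<longleftrightarrow> (\<forall>f\<in>S. \<forall>\<^sub>F (f', g) in uniformity. f' = f \<longrightarrow> g \<in> S)"

instance
proof
  fix f g h :: Yprs and c d :: real
  note rel = Yprs_rel_def Lp_space_add Lp_space_scale
  show "f + g + h = f + (g + h)" "f + g = g + f" "0 + f = f"
    by (transfer; auto simp: rel algebra_simps)+
  show "- f + f = 0"
    unfolding uminus_Yprs_def
    by (transfer, auto simp: rel) (auto simp: Lp_space_def)
  show "f - g = f + - g" by (rule minus_Yprs_def)
  show "c *\<^sub>R (f + g) = c *\<^sub>R f + c *\<^sub>R g" "(c + d) *\<^sub>R f = c *\<^sub>R f + d *\<^sub>R f"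
    "c *\<^sub>R d *\<^sub>R f = (c * d) *\<^sub>R f" "1 *\<^sub>R f = f"
    by (transfer; auto simp: rel algebra_simps)+
  show "dist f g = norm (f - g)" by (rule dist_Yprs_def)
  show "sgn f = inverse (norm f) *\<^sub>R f" by (rule sgn_Yprs_def)
  show "(uniformity :: (Yprs \<times> Yprs) filter) = (INF e\<in>{0<..}. principal {(f, g). dist f g < e})"
    by (rule uniformity_Yprs_def)
  show "open S \<longleftrightarrow> (\<forall>f\<in>S. \<forall>\<^sub>F (f', g) in uniformity. f' = f \<longrightarrow> g \<in> S)" for S :: "Yprs set"
    by (rule open_Yprs_def)
  show "norm f = 0 \<longleftrightarrow> f = 0"
    by (transfer, auto simp: Yprs_rel_def Lp_norm_eq_0_iff) (auto simp: Lp_space_def)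
  show "norm (f + g) \<le> norm f + norm g"
    by transfer (auto simp: Yprs_rel_def intro: Lp_norm_triangle)
  show "norm (c *\<^sub>R f) = \<bar>c\<bar> * norm f"
    by transfer (simp add: Lp_norm_scale)
qed

end

text \<open>
  The Riesz transform with symbol \<open>- \<i> \<xi>\<^sub>j / |\<xi>|\<close> as a principal value integral; the constant is
  \<open>\<Gamma>(2) / \<pi>\<^sup>2\<close>. For \<open>f \<in> L\<^sup>p\<close>, \<open>1 < p < \<infinity>\<close>, the limit exists almost everywhere
  (elsewhere \<^const>\<open>Lim\<close> has an arbitrary fixed value).
\<close>

definition riesz :: "3 \<Rightarrow> (real^3 \<Rightarrow> real) \<Rightarrow> real^3 \<Rightarrow> real"
  where "riesz j f x = 1 / pi\<^sup>2 *
    Lim (at_right 0) (\<lambda>\<epsilon>. LINT y:{y. \<epsilon> < norm y}|lebesgue. y $ j / norm y ^ 4 * f (x - y))"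

text \<open>
  \<open>R\<^sub>i R\<^sub>j F\<^sub>i\<^sub>j\<close>, summed over \<open>i\<close> and \<open>j\<close>, for a tensor field on \<open>I \<times> B\<^sub>1\<close>: extension by zero to
  \<open>\<real>\<^sup>3\<close>, Riesz transforms in space at each time, restriction to \<open>B\<^sub>1\<^sub>/\<^sub>2\<close> (which is taking the class
  in \<^typ>\<open>Yprs\<close>). For entries in \<open>L\<^sup>3\<^sup>/\<^sup>2(I; L\<^sup>3\<^sup>/\<^sup>2(B\<^sub>1))\<close> the representative lies in \<open>L\<^sup>3\<^sup>/\<^sup>2\<close> by the
  Calderon-Zygmund theorem.
\<close>

definition riesz_pressure :: "(spacetime \<Rightarrow> real^3^3) \<Rightarrow> Yprs"
  where "riesz_pressure F = abs_Yprs (\<lambda>(t, x).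
    \<Sum>i\<in>UNIV. \<Sum>j\<in>UNIV. riesz i (riesz j (\<lambda>y. if y \<in> ball 0 1 then F (t, y) $ i $ j else 0)) x)"

text \<open>
  The spaces \<open>X\<^sub>k\<^sup>(\<^sup>j\<^sup>)\<close> are realised as subspaces \<^term>\<open>X k j\<close> of one real vector space (any family of
  vector spaces embeds in its direct sum), each with a norm \<^term>\<open>nX k j\<close> of its own.
\<close>

definition is_norm_on :: "'x::real_vector set \<Rightarrow> ('x \<Rightarrow> real) \<Rightarrow> bool"
  where "is_norm_on V n \<longleftrightarrow> subspace V
    \<and> (\<forall>x\<in>V. n x \<ge> 0 \<and> (n x = 0 \<longleftrightarrow> x = 0))
    \<and> (\<forall>x\<in>V. \<forall>c. n (c *\<^sub>R x) = \<bar>c\<bar> * n x)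
    \<and> (\<forall>x\<in>V. \<forall>y\<in>V. n (x + y) \<le> n x + n y)"

type_synonym 'x package = "int \<Rightarrow> nat \<Rightarrow> 'x"

definition packages :: "int set \<Rightarrow> (int \<Rightarrow> nat \<Rightarrow> 'x::real_vector set) \<Rightarrow> 'x package set"
  where "packages \<Lambda> X = {D. (\<forall>k\<in>\<Lambda>. \<forall>j\<in>{1..7}. D k j \<in> X k j)
    \<and> (\<forall>k j. \<not> (k \<in> \<Lambda> \<and> j \<in> {1..7}) \<longrightarrow> D k j = 0)}"

definition norm_loc_int ::
    "int set \<Rightarrow> (nat \<Rightarrow> real) \<Rightarrow> (int \<Rightarrow> nat \<Rightarrow> 'x \<Rightarrow> real) \<Rightarrow> 'x package \<Rightarrow> real"
  where "norm_loc_int \<Lambda> a nX D = sqrt (\<Sum>k\<in>\<Lambda>. \<Sum>j = 1..7. a j * (nX k j (D k j))\<^sup>2)"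

lemma subspace_packages:
  assumes "\<And>k j. k \<in> \<Lambda> \<Longrightarrow> j \<in> {1..7} \<Longrightarrow> subspace (X k j)"
  shows "subspace (packages \<Lambda> X)"
  using assms unfolding subspace_def packages_def
  by (auto simp: scaleR_fun_def)

definition clean_source ::
    "('x package \<Rightarrow> spacetime \<Rightarrow> real^3) \<Rightarrow> ('x package \<Rightarrow> spacetime \<Rightarrow> real^3^3)
      \<Rightarrow> 'x package \<Rightarrow> spacetime \<Rightarrow> real^3^3"
  where "clean_source U R D z = (\<chi> i j. U D z $ i * U D z $ j + R D z $ i $ j)"

definition T_proj ::
    "(Yprs \<Rightarrow>\<^sub>L Yprs)
      \<Rightarrow> ('x::real_vector package \<Rightarrow> spacetime \<Rightarrow> real^3)
      \<Rightarrow> ('x package \<Rightarrow> spacetime \<Rightarrow> real^3^3)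
      \<Rightarrow> 'x package \<Rightarrow> 'x package \<Rightarrow> real"
  where "T_proj P U R D \<zeta> = (1 + norm P) * norm (riesz_pressure (clean_source U R (D - \<zeta>)))"

definition T_harm ::
    "('h::real_normed_vector \<Rightarrow>\<^sub>L Yprs) \<Rightarrow> ('h \<Rightarrow>\<^sub>L 'h) \<Rightarrow> ('x::real_vector package \<Rightarrow> 'h)
      \<Rightarrow> 'x package \<Rightarrow> 'x package \<Rightarrow> real"
  where "T_harm J Q p_harm D \<zeta> = norm J * norm ((id_blinfun - Q) (p_harm (D - \<zeta>)))"

text \<open>The arguments \<open>Tp\<close> and \<open>Th\<close> stand for \<^term>\<open>T_proj P U R\<close> and \<^term>\<open>T_harm J Q p_harm\<close>.\<close>

definition dist_sharp_tail ::
    "('x::real_vector package \<Rightarrow> real) \<Rightarrow> 'x package set \<Rightarrow> real \<Rightarrow> real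
      \<Rightarrow> ('x package \<Rightarrow> 'x package \<Rightarrow> real) \<Rightarrow> ('x package \<Rightarrow> 'x package \<Rightarrow> real)
      \<Rightarrow> 'x package \<Rightarrow> real"
  where "dist_sharp_tail nloc \<Gamma> \<alpha>\<^sub>p \<alpha>\<^sub>h Tp Th D
    = (INF \<zeta>\<in>\<Gamma>. nloc (D - \<zeta>) + \<alpha>\<^sub>p * Tp D \<zeta> + \<alpha>\<^sub>h * Th D \<zeta>)"

definition finite_dimensional :: "'a::real_vector set \<Rightarrow> bool"
  where "finite_dimensional V \<longleftrightarrow> (\<exists>B. finite B \<and> V \<subseteq> span B)"

end

theory Submission
  imports Defs
begin

text \<open>The selected \<open>\<zeta>s D\<close> is one competitor in the infimum defining the
  tail distance, so that distance is at most \<open>A + B + C\<close>, the three weighted channels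
  evaluated at \<open>\<zeta>s D\<close> (\<open>dist_sharp_tail_le\<close>). Each channel is
  controlled separately by the clean distance; averaging the three bounds with weight 1/3 each
  controls the sum with the smallest of the three constants (\<open>visibility_average\<close>).
  Both steps rest on the nonnegativity of the channels: it keeps the infimum bounded below and
  allows each constant to be lowered to the minimum. The argument is pure order and arithmetic; no
  property of the Riesz transforms enters.\<close>

lemma norm_loc_int_nonneg:
  assumes "\<And>j. j \<in> {1..7} \<Longrightarrow> a j \<ge> 0"
  shows "norm_loc_int \<Lambda> a nX D \<ge> 0"
  using assms unfolding norm_loc_int_def by (intro real_sqrt_ge_zero sum_nonneg mult_nonneg_nonneg) auto

lemma T_proj_nonneg: "T_proj P U R D \<zeta> \<ge> 0"
  by (simp add: T_proj_def)

lemma T_harm_nonneg: "T_harm J Q p_harm D \<zeta> \<ge> 0"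
  by (simp add: T_harm_def)

text \<open>An infimum of reals lies below its members only when the set is bounded below; the sign
  hypotheses supply the lower bound 0.\<close>

lemma dist_sharp_tail_le:
  assumes "\<zeta> \<in> \<Gamma>" "\<alpha>\<^sub>p \<ge> 0" "\<alpha>\<^sub>h \<ge> 0"
    and "\<And>D. nloc D \<ge> 0" "\<And>D \<zeta>. Tp D \<zeta> \<ge> 0" "\<And>D \<zeta>. Th D \<zeta> \<ge> 0"
  shows "dist_sharp_tail nloc \<Gamma> \<alpha>\<^sub>p \<alpha>\<^sub>h Tp Th D
    \<le> nloc (D - \<zeta>) + \<alpha>\<^sub>p * Tp D \<zeta> + \<alpha>\<^sub>h * Th D \<zeta>"
  unfolding dist_sharp_tail_def
  using assms by (intro cINF_lower bdd_belowI2[of _ 0]) auto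

text \<open>Add the three bounds and divide by 3: this is the source of the factor 1/3 in both
  \<open>lamG\<close> and \<open>\<delta>Gvis\<close>. Lowering each constant to
  \<open>\<kappa>\<close> weakens its bound because \<open>A\<close>, \<open>B\<close>,
  \<open>C\<close> are nonnegative.\<close>

lemma visibility_average:
  fixes d A B C :: real
  assumes "d \<ge> \<kappa>1 * A - \<delta>1" "d \<ge> \<kappa>2 * B - \<delta>2" "d \<ge> \<kappa>3 * C - \<delta>3"
    and "A \<ge> 0" "B \<ge> 0" "C \<ge> 0"
    and "\<kappa> \<le> \<kappa>1" "\<kappa> \<le> \<kappa>2" "\<kappa> \<le> \<kappa>3"
  shows "d \<ge> \<kappa> / 3 * (A + B + C) - (\<delta>1 + \<delta>2 + \<delta>3) / 3"
proof -
  have "\<kappa> * A \<le> \<kappa>1 * A" "\<kappa> * B \<le> \<kappa>2 * B" "\<kappa> * C \<le> \<kappa>3 * C"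
    using assms by (auto intro: mult_right_mono)
  with assms(1-3) show ?thesis
    by (simp add: field_simps)
qed

theorem proposition9p95:
  fixes \<Gamma>cl :: "'c::real_normed_vector set"
    and \<Lambda> :: "int set"
    and X :: "int \<Rightarrow> nat \<Rightarrow> 'x::real_vector set"
    and nX :: "int \<Rightarrow> nat \<Rightarrow> 'x \<Rightarrow> real"
    and a :: "nat \<Rightarrow> real"
    and \<Gamma>int :: "'x package set"
    and \<Theta> :: "'x package \<Rightarrow> 'c"
    and U :: "'x package \<Rightarrow> spacetime \<Rightarrow> real^3"
    and R :: "'x package \<Rightarrow> spacetime \<Rightarrow> real^3^3"
    and p_harm :: "'x package \<Rightarrow> 'h::real_normed_vector"
    and P :: "Yprs \<Rightarrow>\<^sub>L Yprs"
    and Q :: "'h \<Rightarrow>\<^sub>L 'h"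
    and J :: "'h \<Rightarrow>\<^sub>L Yprs"
    and \<zeta>s :: "'x package \<Rightarrow> 'x package"
    and \<alpha>proj \<alpha>harm \<kappa>0 \<kappa>proj \<kappa>harm \<delta>0 \<delta>proj \<delta>harm :: real
  defines "dist_cl \<equiv> \<lambda>d. infdist d \<Gamma>cl"
    and "nloc \<equiv> norm_loc_int \<Lambda> a nX"
    and "Tproj \<equiv> T_proj P U R"
    and "Tharm \<equiv> T_harm J Q p_harm"
  defines "dist_tail \<equiv> dist_sharp_tail nloc \<Gamma>int \<alpha>proj \<alpha>harm Tproj Tharm"
  defines "\<kappa>s \<equiv> Min {\<kappa>0, \<kappa>proj, \<kappa>harm}"
  defines "lamG \<equiv> min 1 (\<kappa>s / 3)"
    and "\<delta>Gvis \<equiv> (\<delta>0 + \<delta>proj + \<delta>harm) / 3"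
  assumes clean: "finite_dimensional (UNIV :: 'c set)" "subspace \<Gamma>cl"
    and Lambda: "\<exists>m n. \<Lambda> = {m..n}"
    and coords: "\<And>k j. k \<in> \<Lambda> \<Longrightarrow> j \<in> {1..7} \<Longrightarrow> is_norm_on (X k j) (nX k j)"
    and weights: "\<And>j. j \<in> {1..7} \<Longrightarrow> a j > 0"
    and Gint: "\<Gamma>int \<subseteq> packages \<Lambda> X" "subspace \<Gamma>int"
    and source: "\<And>D i j. D \<in> packages \<Lambda> X \<Longrightarrow>
        (\<lambda>z. clean_source U R D z $ i $ j) \<in> Lp_space (3/2) (cylinder 1)"
    and proj_P: "P o\<^sub>L P = P"
    and proj_Q: "Q o\<^sub>L Q = Q" "finite_dimensional (range Q)"
    and alphas: "\<alpha>proj > 0" "\<alpha>harm > 0"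
    and selection: "\<And>D. D \<in> packages \<Lambda> X \<Longrightarrow> \<zeta>s D \<in> \<Gamma>int"
    and kappas: "\<kappa>0 > 0" "\<kappa>proj > 0" "\<kappa>harm > 0"
    and deltas: "\<delta>0 \<ge> 0" "\<delta>proj \<ge> 0" "\<delta>harm \<ge> 0"
    and vis_0: "\<And>D. D \<in> packages \<Lambda> X \<Longrightarrow>
        dist_cl (\<Theta> D) \<ge> \<kappa>0 * nloc (D - \<zeta>s D) - \<delta>0"
    and vis_proj: "\<And>D. D \<in> packages \<Lambda> X \<Longrightarrow>
        dist_cl (\<Theta> D) \<ge> \<kappa>proj * \<alpha>proj * Tproj D (\<zeta>s D) - \<delta>proj"
    and vis_harm: "\<And>D. D \<in> packages \<Lambda> X \<Longrightarrow>
        dist_cl (\<Theta> D) \<ge> \<kappa>harm * \<alpha>harm * Tharm D (\<zeta>s D) - \<delta>harm"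
  shows "(\<forall>D\<in>packages \<Lambda> X. dist_cl (\<Theta> D) \<ge> lamG * dist_tail D - \<delta>Gvis)
    \<and> (\<forall>\<epsilon>G \<delta>G. 1 - \<epsilon>G = lamG \<and> \<delta>G = \<delta>Gvis \<longrightarrow>
          (\<forall>D\<in>packages \<Lambda> X. dist_cl (\<Theta> D) \<ge> (1 - \<epsilon>G) * dist_tail D - \<delta>G))"
proof -
  have main: "dist_cl (\<Theta> D) \<ge> lamG * dist_tail D - \<delta>Gvis" if D: "D \<in> packages \<Lambda> X" for D
  proof -
    \<comment> \<open>The weights \<alpha> are absorbed into \<open>B\<close> and \<open>C\<close>,
      so that \<open>A + B + C\<close> is exactly the functional under the infimum, taken at
      \<open>\<zeta>s D\<close>.\<close>
    define A B C where "A = nloc (D - \<zeta>s D)" and "B = \<alpha>proj * Tproj D (\<zeta>s D)"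
      and "C = \<alpha>harm * Tharm D (\<zeta>s D)"
    have nloc: "nloc D' \<ge> 0" for D'
      unfolding nloc_def using weights by (intro norm_loc_int_nonneg) (simp add: less_imp_le)
    have T: "Tproj D' \<zeta> \<ge> 0" "Tharm D' \<zeta> \<ge> 0" for D' \<zeta>
      by (simp_all add: Tproj_def Tharm_def T_proj_nonneg T_harm_nonneg)
    have nonneg: "A \<ge> 0" "B \<ge> 0" "C \<ge> 0"
      using nloc T alphas by (simp_all add: A_def B_def C_def)
    have \<kappa>s: "\<kappa>s > 0" "\<kappa>s \<le> \<kappa>0" "\<kappa>s \<le> \<kappa>proj" "\<kappa>s \<le> \<kappa>harm"
      using kappas by (simp_all add: \<kappa>s_def)
    have "dist_tail D \<le> A + B + C"
      unfolding dist_tail_def A_def B_def C_def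
      using selection[OF D] alphas nloc T by (intro dist_sharp_tail_le) auto
    then have "lamG * dist_tail D \<le> lamG * (A + B + C)"
      using \<kappa>s(1) by (intro mult_left_mono) (auto simp: lamG_def)
    \<comment> \<open>The cap at 1 can only decrease \<open>lamG\<close>, and the sum it multiplies
      is nonnegative.\<close>
    also have "\<dots> \<le> \<kappa>s / 3 * (A + B + C)"
      using nonneg by (intro mult_right_mono) (auto simp: lamG_def)
    finally have "lamG * dist_tail D \<le> \<kappa>s / 3 * (A + B + C)" .
    moreover have "dist_cl (\<Theta> D) \<ge> \<kappa>s / 3 * (A + B + C) - \<delta>Gvis"
      unfolding \<delta>Gvis_def
      using vis_0[OF D] vis_proj[OF D] vis_harm[OF D] nonneg \<kappa>s
      by (intro visibility_average[of \<kappa>0 _ _ _ \<kappa>proj _ _ \<kappa>harm]) (simp_all add: A_def B_def C_def mult.assoc)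
    ultimately show ?thesis by linarith
  qed
  \<comment> \<open>The second conjunct is the first after substituting \<open>lamG\<close> for
    \<open>1 - \<epsilon>G\<close> and \<open>\<delta>Gvis\<close> for
    \<open>\<delta>G\<close>.\<close>
  then show ?thesis by simp
qed

end
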